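(* Let $\mathbf{B} = (B; \cap, \cup, ', 0, 1)$ be a Boolean algebra. Then the contract algebra $\mathbf{C(B)} = (C(B); \wedge, \vee, \neg, D, \bot, \gamma, \top)$ on $\mathbf{B}$ is a c3dp-algebra (with bottom $\bot$, top $\top$ and distinguished constant $c=\gamma$).
   Context: Contract algebra on $\mathbf{B}$: $C(B) = \{(a,b) \in B\times B : a \cup b = 1\}$, with operations $(a,b)\wedge(c,d) = (a\cup c, b\cap d)$, $(a,b)\vee(c,d) = (a\cap c, b\cup d)$, $\neg(a,b) = (b,b')$, $D(a,b) = (a',a)$, $\bot = (1,0)$, $\gamma = (1,1)$, $\top=(0,1)$. A dp-algebra (double p-algebra) is an algebra $(A;\wedge,\vee,\neg,D,0,1)$ of type $(2,2,1,1,0,0)$ such that $(A;\wedge,\vee,0,1)$ is a bounded distributive lattice; for every $a\in A$, $\neg a$ is the greatest $b\in A$ with $a\wedge b=0$; and for every $a\in A$, $Da$ is the smallest $b\in A$ with $a\vee b=1$. It is regular if $a\wedge Da\le b\vee\neg b$ for all $a,b\in A$. A three-valued dp-algebra is a regular dp-algebra satisfying $\neg x\vee\neg\neg x=1$ and $Dx\wedge DDx=0$. A c3dp-algebra (centred three-valued dp-algebra) is an algebra $(A;\wedge,\vee,\neg,D,0,c,1)$ such that $(A;\wedge,\vee,\neg,D,0,1)$ is a three-valued dp-algebra and the constant $c$ satisfies $\neg c=0$ and $Dc=1$. *)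

theory Defs
  imports Main
begin

text \<open>
  Algebras are given by a carrier set \<open>A\<close> together with operations on the ambient type.
  \<open>A\<close> is nonempty, since it contains the constants.
\<close>

locale bounded_distrib_lattice_on =
  fixes A :: "'a set"
    and meet :: "'a \<Rightarrow> 'a \<Rightarrow> 'a" (infixl "\<sqinter>" 70)
    and join :: "'a \<Rightarrow> 'a \<Rightarrow> 'a" (infixl "\<squnion>" 65)
    and zero :: 'a ("\<zero>")
    and one :: 'a ("\<one>")
  assumes meet_closed: "\<lbrakk>x \<in> A; y \<in> A\<rbrakk> \<Longrightarrow> x \<sqinter> y \<in> A"
    and join_closed: "\<lbrakk>x \<in> A; y \<in> A\<rbrakk> \<Longrightarrow> x \<squnion> y \<in> A"
    and zero_closed: "\<zero> \<in> A"
    and one_closed: "\<one> \<in> A"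
    and meet_idem: "x \<in> A \<Longrightarrow> x \<sqinter> x = x"
    and join_idem: "x \<in> A \<Longrightarrow> x \<squnion> x = x"
    and meet_commute: "\<lbrakk>x \<in> A; y \<in> A\<rbrakk> \<Longrightarrow> x \<sqinter> y = y \<sqinter> x"
    and join_commute: "\<lbrakk>x \<in> A; y \<in> A\<rbrakk> \<Longrightarrow> x \<squnion> y = y \<squnion> x"
    and meet_assoc: "\<lbrakk>x \<in> A; y \<in> A; z \<in> A\<rbrakk> \<Longrightarrow> (x \<sqinter> y) \<sqinter> z = x \<sqinter> (y \<sqinter> z)"
    and join_assoc: "\<lbrakk>x \<in> A; y \<in> A; z \<in> A\<rbrakk> \<Longrightarrow> (x \<squnion> y) \<squnion> z = x \<squnion> (y \<squnion> z)"
    and meet_join_absorb: "\<lbrakk>x \<in> A; y \<in> A\<rbrakk> \<Longrightarrow> x \<sqinter> (x \<squnion> y) = x"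
    and join_meet_absorb: "\<lbrakk>x \<in> A; y \<in> A\<rbrakk> \<Longrightarrow> x \<squnion> (x \<sqinter> y) = x"
    and meet_join_distrib:
      "\<lbrakk>x \<in> A; y \<in> A; z \<in> A\<rbrakk> \<Longrightarrow> x \<sqinter> (y \<squnion> z) = (x \<sqinter> y) \<squnion> (x \<sqinter> z)"
    and zero_meet: "x \<in> A \<Longrightarrow> \<zero> \<sqinter> x = \<zero>"
    and one_join: "x \<in> A \<Longrightarrow> \<one> \<squnion> x = \<one>"
begin

definition le :: "'a \<Rightarrow> 'a \<Rightarrow> bool" (infix "\<sqsubseteq>" 50)
  where "x \<sqsubseteq> y \<longleftrightarrow> x \<sqinter> y = x"

end

locale dp_algebra = bounded_distrib_lattice_on A meet join zero one
  for A :: "'a set"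
    and meet :: "'a \<Rightarrow> 'a \<Rightarrow> 'a" (infixl "\<sqinter>" 70)
    and join :: "'a \<Rightarrow> 'a \<Rightarrow> 'a" (infixl "\<squnion>" 65)
    and neg :: "'a \<Rightarrow> 'a"
    and D :: "'a \<Rightarrow> 'a"
    and zero :: 'a ("\<zero>")
    and one :: 'a ("\<one>") +
  assumes neg_closed: "x \<in> A \<Longrightarrow> neg x \<in> A"
    and meet_neg: "x \<in> A \<Longrightarrow> x \<sqinter> neg x = \<zero>"
    and neg_greatest: "\<lbrakk>x \<in> A; y \<in> A; x \<sqinter> y = \<zero>\<rbrakk> \<Longrightarrow> y \<sqsubseteq> neg x"
    and D_closed: "x \<in> A \<Longrightarrow> D x \<in> A"
    and join_D: "x \<in> A \<Longrightarrow> x \<squnion> D x = \<one>"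
    and D_least: "\<lbrakk>x \<in> A; y \<in> A; x \<squnion> y = \<one>\<rbrakk> \<Longrightarrow> D x \<sqsubseteq> y"

locale regular_dp_algebra = dp_algebra +
  assumes regular: "\<lbrakk>x \<in> A; y \<in> A\<rbrakk> \<Longrightarrow> x \<sqinter> D x \<sqsubseteq> y \<squnion> neg y"

locale three_valued_dp_algebra = regular_dp_algebra +
  assumes neg_join_neg_neg: "x \<in> A \<Longrightarrow> neg x \<squnion> neg (neg x) = \<one>"
    and D_meet_D_D: "x \<in> A \<Longrightarrow> D x \<sqinter> D (D x) = \<zero>"

locale c3dp_algebra = three_valued_dp_algebra A meet join neg D zero one
  for A :: "'a set"
    and meet :: "'a \<Rightarrow> 'a \<Rightarrow> 'a" (infixl "\<sqinter>" 70)
    and join :: "'a \<Rightarrow> 'a \<Rightarrow> 'a" (infixl "\<squnion>" 65)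
    and neg :: "'a \<Rightarrow> 'a"
    and D :: "'a \<Rightarrow> 'a"
    and zero :: 'a ("\<zero>")
    and c :: 'a
    and one :: 'a ("\<one>") +
  assumes c_closed: "c \<in> A"
    and neg_c: "neg c = \<zero>"
    and D_c: "D c = \<one>"

text \<open>
  The contract algebra on the Boolean algebra \<open>'b\<close>. The operations are defined on all pairs;
  that they restrict to \<open>contracts\<close> is part of the closure conditions above.
\<close>

definition contracts :: "('b::boolean_algebra \<times> 'b) set"
  where "contracts = {(a, b). sup a b = top}"

fun contract_meet :: "'b::boolean_algebra \<times> 'b \<Rightarrow> 'b \<times> 'b \<Rightarrow> 'b \<times> 'b"
  where "contract_meet (a, b) (c, d) = (sup a c, inf b d)"

fun contract_join :: "'b::boolean_algebra \<times> 'b \<Rightarrow> 'b \<times> 'b \<Rightarrow> 'b \<times> 'b"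
  where "contract_join (a, b) (c, d) = (inf a c, sup b d)"

fun contract_neg :: "'b::boolean_algebra \<times> 'b \<Rightarrow> 'b \<times> 'b"
  where "contract_neg (a, b) = (b, - b)"

fun contract_D :: "'b::boolean_algebra \<times> 'b \<Rightarrow> 'b \<times> 'b"
  where "contract_D (a, b) = (- a, a)"

definition contract_bot :: "'b::boolean_algebra \<times> 'b"
  where "contract_bot = (top, bot)"

definition contract_gamma :: "'b::boolean_algebra \<times> 'b"
  where "contract_gamma = (top, top)"

definition contract_top :: "'b::boolean_algebra \<times> 'b"
  where "contract_top = (bot, top)"

end

theory Submission
  imports Defs
begin

text \<open>\<open>contracts\<close> is a bounded sublattice of B^op \<times> B: the order is
  reversed in the first coordinate, and the lattice laws hold componentwise. The condition a
  \<union> b = 1 ties the coordinates together: it makes x \<and> \<not>x bottom and x \<or> Dx top,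
  and for a competitor (c, d) it turns disjointness from b or a into a bound on the other coordinate
  (\<open>le_of_sup_top_inf_bot\<close>). Values of \<not> and D are complementary pairs, whence the
  two Stone identities.\<close>

text \<open>Both \<open>x\<close> and the complement of \<open>z\<close> are compared with the
  complement of \<open>y\<close>: it is below \<open>x\<close> and above \<open>z\<close>.\<close>

lemma le_of_sup_top_inf_bot:
  fixes x y z :: "'b::boolean_algebra"
  assumes "sup x y = top" and "inf y z = bot"
  shows "z \<le> x"
proof -
  have "z = inf z (sup x y)"
    using assms(1) by simp
  also have "\<dots> = inf z x"
    using assms(2) by (simp add: inf_sup_distrib1 inf_commute[of z y])
  finally show ?thesis
    by (simp add: le_iff_inf)
qed

lemma bounded_distrib_lattice_on_contracts:
  "bounded_distrib_lattice_on (contracts :: ('b::boolean_algebra \<times> 'b) set)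
    contract_meet contract_join contract_bot contract_top"
proof
  fix x y :: "'b \<times> 'b"
  assume "x \<in> contracts" "y \<in> contracts"
  moreover obtain a b c d where xy: "x = (a, b)" "y = (c, d)"
    by (metis surj_pair)
  ultimately have ab: "sup a b = top" and cd: "sup c d = top"
    by (simp_all add: contracts_def)
  \<comment> \<open>Lets the simplifier find a \<union> b = 1 inside the longer, reordered joins
    that distributivity produces.\<close>
  have abu: "sup a (sup b u) = top" for u
    using ab by (simp add: sup_assoc[symmetric])
  show "contract_meet x y \<in> contracts" "contract_join x y \<in> contracts"
    by (simp_all add: xy abu cd contracts_def sup_inf_distrib1 sup_inf_distrib2 sup.assoc
        sup.commute sup.left_commute)
next
  fix x y z :: "'b \<times> 'b"
  show "contract_meet x (contract_join y z)
    = contract_join (contract_meet x y) (contract_meet x z)"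
    by (cases x; cases y; cases z) (simp, intro conjI sup_inf_distrib1 inf_sup_distrib1)
next
  show "contract_bot \<in> contracts" "contract_top \<in> contracts"
    by (simp_all add: contracts_def contract_bot_def contract_top_def)
qed (auto simp: contract_bot_def contract_top_def inf.assoc sup.assoc
    intro: inf.commute sup.commute)

lemma three_valued_dp_algebra_contracts:
  "three_valued_dp_algebra (contracts :: ('b::boolean_algebra \<times> 'b) set)
    contract_meet contract_join contract_neg contract_D contract_bot contract_top"
proof -
  interpret bounded_distrib_lattice_on "contracts :: ('b \<times> 'b) set"
    contract_meet contract_join contract_bot contract_top
    by (rule bounded_distrib_lattice_on_contracts)
  have le_iff: "le (a, b) (c, d) \<longleftrightarrow> c \<le> a \<and> b \<le> d" for a b c d :: 'b
    by (simp add: le_def sup.absorb_iff1[of c a] inf.absorb_iff1[of b d])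
  show ?thesis
  proof
    fix x y :: "'b \<times> 'b"
    assume "x \<in> contracts" and y: "y \<in> contracts"
    obtain a b c d where [simp]: "x = (a, b)" "y = (c, d)"
      by (metis surj_pair)
    from y have cd: "sup c d = top"
      by (simp add: contracts_def)
    show "le y (contract_neg x)" if "contract_meet x y = contract_bot"
    proof -
      have "inf b d = bot"
        using that by (simp add: contract_bot_def)
      \<comment> \<open>The second bound is disjointness alone; the first comes from
        \<open>c\<close> and \<open>d\<close> jointly covering the top.\<close>
      then have "b \<le> c" "d \<le> - b"
        using cd by (metis le_of_sup_top_inf_bot inf_commute, metis inf_commute inf_shunt)
      then show ?thesis
        by (simp add: le_iff)
    qed
    show "le (contract_D x) y" if "contract_join x y = contract_top"
    proof -
      have "inf a c = bot"
        using that by (simp add: contract_top_def)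
      then have "a \<le> d" "c \<le> - a"
        using cd by (metis le_of_sup_top_inf_bot inf_commute sup_commute,
            metis inf_commute inf_shunt)
      then show ?thesis
        by (simp add: le_iff)
    qed
    \<comment> \<open>The element (1, 1) separates the sides: the left is (1, b \<inter> a), the
      right (c \<inter> d, 1).\<close>
    show "le (contract_meet x (contract_D x)) (contract_join y (contract_neg y))"
      by (simp add: le_iff)
  qed (auto simp: contracts_def contract_bot_def contract_top_def sup_commute)
qed

theorem proposition3p3:
  shows "c3dp_algebra (contracts :: ('b::boolean_algebra \<times> 'b) set)
    contract_meet contract_join contract_neg contract_D
    contract_bot contract_gamma contract_top"
  \<comment> \<open>For the centre, \<not>(1, 1) = (1, 0) and D(1, 1) = (0, 1).\<close>
  by (intro c3dp_algebra.intro three_valued_dp_algebra_contracts c3dp_algebra_axioms.intro)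
    (simp_all add: contracts_def contract_bot_def contract_gamma_def contract_top_def)

end
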